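(* Let $\Gamma$ be a finite simplicial graph, let $G_\Gamma$ be the graph product of groups $\{G_i\}_{i\in V(\Gamma)}$, and let $K_\Gamma=\ker\big(G_\Gamma\to\prod_{i\in V(\Gamma)}G_i\big)$. (i) If each $G_i$ is infinite countable, then $K_\Gamma$ is isomorphic to the commutator subgroup of the right-angled Artin group $A_\Gamma$ on $\Gamma$. (ii) If each $G_i$ is countable, then $K_\Gamma$ is a retract of the commutator subgroup of the right-angled Artin group $A_\Gamma$ on $\Gamma$. (iii) If each $G_i$ is nontrivial, then the commutator subgroup of the right-angled Coxeter group $W_\Gamma$ on $\Gamma$ is a retract of $K_\Gamma$.
   Context: The graph product $G_\Gamma$ of groups $\{G_i\}_{i\in V(\Gamma)}$ is the quotient of the free product of the $G_i$ by the relations $[g_i,g_j]=1$ for all $g_i\in G_i$, $g_j\in G_j$ whenever $\{i,j\}$ is an edge of $\Gamma$. The map $G_\Gamma\to\prod_iG_i$ is the canonical epimorphism which is the identity on each vertex group. $A_\Gamma$ is the graph product with all vertex groups $\mathbb Z$; $W_\Gamma$ is the graph product with all vertex groups cyclic of order $2$. A group $A$ is a retract of a group $B$ if there are homomorphisms $\iota:A\to B$ and $r:B\to A$ with $r\circ\iota=\mathrm{id}_A$. *)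

theory Defs
  imports "HOL-Algebra.Generated_Groups" "HOL-Algebra.Product_Groups" "HOL-Library.Countable_Set"
begin

definition finite_simplicial_graph :: "'v set \<Rightarrow> 'v set set \<Rightarrow> bool" where
  "finite_simplicial_graph V E \<longleftrightarrow> finite V \<and> (\<forall>e\<in>E. e \<subseteq> V \<and> card e = 2)"

text \<open>A letter \<open>(i, g)\<close> stands for the element \<open>g\<close> of the \<open>i\<close>-th factor, and the free product consists
  of the words in such letters modulo the congruence generated by deleting the identity of a factor
  and by multiplying adjacent letters of the same factor.\<close>

definition free_words :: "'v set \<Rightarrow> ('v \<Rightarrow> ('a, 'b) monoid_scheme) \<Rightarrow> ('v \<times> 'a) list set" where
  "free_words V G = lists (SIGMA i:V. carrier (G i))"

inductive free_step ::
    "'v set \<Rightarrow> ('v \<Rightarrow> ('a, 'b) monoid_scheme) \<Rightarrow> ('v \<times> 'a) list \<Rightarrow> ('v \<times> 'a) list \<Rightarrow> bool"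
  for V G where
    one: "\<lbrakk>xs \<in> free_words V G; ys \<in> free_words V G; i \<in> V\<rbrakk>
      \<Longrightarrow> free_step V G (xs @ [(i, \<one>\<^bsub>G i\<^esub>)] @ ys) (xs @ ys)"
  | mult: "\<lbrakk>xs \<in> free_words V G; ys \<in> free_words V G; i \<in> V; g \<in> carrier (G i); h \<in> carrier (G i)\<rbrakk>
      \<Longrightarrow> free_step V G (xs @ [(i, g), (i, h)] @ ys) (xs @ [(i, g \<otimes>\<^bsub>G i\<^esub> h)] @ ys)"

definition free_cong ::
    "'v set \<Rightarrow> ('v \<Rightarrow> ('a, 'b) monoid_scheme) \<Rightarrow> (('v \<times> 'a) list \<times> ('v \<times> 'a) list) set" where
  "free_cong V G =
    {(u, v). u \<in> free_words V G \<and> v \<in> free_words V G \<and> equivclp (free_step V G) u v}"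

definition free_product ::
    "'v set \<Rightarrow> ('v \<Rightarrow> ('a, 'b) monoid_scheme) \<Rightarrow> ('v \<times> 'a) list set monoid" where
  "free_product V G =
    \<lparr>carrier = free_words V G // free_cong V G,
     monoid.mult = (\<lambda>X Y. \<Union>u\<in>X. \<Union>v\<in>Y. free_cong V G `` {u @ v}),
     one = free_cong V G `` {[]}\<rparr>"

definition free_incl ::
    "'v set \<Rightarrow> ('v \<Rightarrow> ('a, 'b) monoid_scheme) \<Rightarrow> 'v \<Rightarrow> 'a \<Rightarrow> ('v \<times> 'a) list set" where
  "free_incl V G i g = free_cong V G `` {[(i, g)]}"

definition normal_closure :: "('a, 'b) monoid_scheme \<Rightarrow> 'a set \<Rightarrow> 'a set" where
  "normal_closure G S = \<Inter>{N. N \<lhd> G \<and> S \<subseteq> N}"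

definition commutator :: "('a, 'b) monoid_scheme \<Rightarrow> 'a \<Rightarrow> 'a \<Rightarrow> 'a" where
  "commutator G x y = x \<otimes>\<^bsub>G\<^esub> y \<otimes>\<^bsub>G\<^esub> inv\<^bsub>G\<^esub> x \<otimes>\<^bsub>G\<^esub> inv\<^bsub>G\<^esub> y"

definition graph_relators ::
    "'v set \<Rightarrow> 'v set set \<Rightarrow> ('v \<Rightarrow> ('a, 'b) monoid_scheme) \<Rightarrow> ('v \<times> 'a) list set set" where
  "graph_relators V E G =
    {commutator (free_product V G) (free_incl V G i g) (free_incl V G j h) | i j g h.
      i \<in> V \<and> j \<in> V \<and> {i, j} \<in> E \<and> g \<in> carrier (G i) \<and> h \<in> carrier (G j)}"

definition graph_product ::
    "'v set \<Rightarrow> 'v set set \<Rightarrow> ('v \<Rightarrow> ('a, 'b) monoid_scheme) \<Rightarrow> ('v \<times> 'a) list set set monoid" where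
  "graph_product V E G =
    free_product V G Mod normal_closure (free_product V G) (graph_relators V E G)"

definition graph_incl ::
    "'v set \<Rightarrow> 'v set set \<Rightarrow> ('v \<Rightarrow> ('a, 'b) monoid_scheme) \<Rightarrow> 'v \<Rightarrow> 'a \<Rightarrow> ('v \<times> 'a) list set set" where
  "graph_incl V E G i g =
    normal_closure (free_product V G) (graph_relators V E G) #>\<^bsub>free_product V G\<^esub> free_incl V G i g"

definition word_lift :: "('c, 'd) monoid_scheme \<Rightarrow> ('v \<Rightarrow> 'a \<Rightarrow> 'c) \<Rightarrow> ('v \<times> 'a) list \<Rightarrow> 'c" where
  "word_lift H f w = foldr (\<lambda>(i, g) x. f i g \<otimes>\<^bsub>H\<^esub> x) w \<one>\<^bsub>H\<^esub>"

text \<open>The homomorphism from the graph product to \<open>H\<close> that is \<open>f i\<close> on the \<open>i\<close>-th vertex group; see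
  \<open>graph_lift_hom\<close>, \<open>graph_lift_incl\<close> and \<open>graph_lift_unique\<close> below. An element of the graph product
  is a coset of classes of words, so the words representing it form its union.\<close>

definition graph_lift ::
    "('c, 'd) monoid_scheme \<Rightarrow> ('v \<Rightarrow> 'a \<Rightarrow> 'c) \<Rightarrow> ('v \<times> 'a) list set set \<Rightarrow> 'c" where
  "graph_lift H f X = the_elem (word_lift H f ` \<Union>X)"

definition product_incl ::
    "'v set \<Rightarrow> ('v \<Rightarrow> ('a, 'b) monoid_scheme) \<Rightarrow> 'v \<Rightarrow> 'a \<Rightarrow> 'v \<Rightarrow> 'a" where
  "product_incl V G i g = (\<lambda>j\<in>V. if j = i then g else \<one>\<^bsub>G j\<^esub>)"

definition canonical_map ::
    "'v set \<Rightarrow> ('v \<Rightarrow> ('a, 'b) monoid_scheme) \<Rightarrow> ('v \<times> 'a) list set set \<Rightarrow> 'v \<Rightarrow> 'a" where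
  "canonical_map V G = graph_lift (product_group V G) (product_incl V G)"

definition graph_product_kernel ::
    "'v set \<Rightarrow> 'v set set \<Rightarrow> ('v \<Rightarrow> ('a, 'b) monoid_scheme) \<Rightarrow> ('v \<times> 'a) list set set monoid" where
  "graph_product_kernel V E G =
    (graph_product V E G)
      \<lparr>carrier := kernel (graph_product V E G) (product_group V G) (canonical_map V G)\<rparr>"

definition RAAG :: "'v set \<Rightarrow> 'v set set \<Rightarrow> ('v \<times> int) list set set monoid" where
  "RAAG V E = graph_product V E (\<lambda>_. integer_group)"

definition RACG :: "'v set \<Rightarrow> 'v set set \<Rightarrow> ('v \<times> int) list set set monoid" where
  "RACG V E = graph_product V E (\<lambda>_. integer_mod_group 2)"

definition commutator_subgroup :: "('a, 'b) monoid_scheme \<Rightarrow> ('a, 'b) monoid_scheme" where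
  "commutator_subgroup G = G\<lparr>carrier := derived G (carrier G)\<rparr>"

definition is_retract_of :: "('a, 'b) monoid_scheme \<Rightarrow> ('c, 'd) monoid_scheme \<Rightarrow> bool" where
  "is_retract_of A B \<longleftrightarrow> (\<exists>\<iota>\<in>hom A B. \<exists>r\<in>hom B A. \<forall>a\<in>carrier A. r (\<iota> a) = a)"

lemma free_words_simps [simp]:
  "[] \<in> free_words V G"
  "(i, g) # w \<in> free_words V G \<longleftrightarrow> i \<in> V \<and> g \<in> carrier (G i) \<and> w \<in> free_words V G"
  "u @ v \<in> free_words V G \<longleftrightarrow> u \<in> free_words V G \<and> v \<in> free_words V G"
  by (auto simp: free_words_def)

lemma equiv_free_cong: "equiv (free_words V G) (free_cong V G)"
  by (rule equivI)
    (auto simp: free_cong_def refl_on_def sym_def trans_def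
      intro: equivclp_sym equivclp_trans)

lemma free_step_context:
  assumes "free_step V G u v" "p \<in> free_words V G" "q \<in> free_words V G"
  shows "free_step V G (p @ u @ q) (p @ v @ q)"
  using assms(1)
proof cases
  case (one xs ys i)
  then show ?thesis
    using free_step.one[of "p @ xs" V G "ys @ q" i] assms by simp
next
  case (mult xs ys i g h)
  then show ?thesis
    using free_step.mult[of "p @ xs" V G "ys @ q" i g h] assms by simp
qed

lemma equivclp_free_step_context:
  assumes "equivclp (free_step V G) u v" "p \<in> free_words V G" "q \<in> free_words V G"
  shows "equivclp (free_step V G) (p @ u @ q) (p @ v @ q)"
  using assms(1)
proof (induction rule: equivclp_induct)
  case (step y z)
  then have "equivclp (free_step V G) (p @ y @ q) (p @ z @ q)"
    using free_step_context[OF _ assms(2,3)] by (meson equivclp_sym r_into_equivclp)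
  with step.IH show ?case by (rule equivclp_trans)
qed simp

lemma free_cong_append:
  assumes "(u, u') \<in> free_cong V G" "(v, v') \<in> free_cong V G"
  shows "(u @ v, u' @ v') \<in> free_cong V G"
proof -
  have "equivclp (free_step V G) (u @ v) (u' @ v)" "equivclp (free_step V G) (u' @ v) (u' @ v')"
    using assms equivclp_free_step_context[of V G u u' "[]" v]
      equivclp_free_step_context[of V G v v' u' "[]"] by (auto simp: free_cong_def)
  then show ?thesis
    using assms by (auto simp: free_cong_def intro: equivclp_trans)
qed

lemma free_cong_refl: "w \<in> free_words V G \<Longrightarrow> (w, w) \<in> free_cong V G"
  by (simp add: free_cong_def)

lemma free_cong_class_eq:
  "(u, v) \<in> free_cong V G \<Longrightarrow> free_cong V G `` {u} = free_cong V G `` {v}"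
  by (rule equiv_class_eq[OF equiv_free_cong])

lemma carrier_free_productE:
  assumes "X \<in> carrier (free_product V G)"
  obtains w where "w \<in> free_words V G" "X = free_cong V G `` {w}"
  using assms by (auto simp: free_product_def elim!: quotientE)

lemma free_class_closed [simp]:
  "w \<in> free_words V G \<Longrightarrow> free_cong V G `` {w} \<in> carrier (free_product V G)"
  by (auto simp: free_product_def intro: quotientI)

lemma mult_free_product:
  assumes "u \<in> free_words V G" "v \<in> free_words V G"
  shows "free_cong V G `` {u} \<otimes>\<^bsub>free_product V G\<^esub> free_cong V G `` {v} = free_cong V G `` {u @ v}"
proof -
  have eq: "free_cong V G `` {u' @ v'} = free_cong V G `` {u @ v}"
    if "(u, u') \<in> free_cong V G" "(v, v') \<in> free_cong V G" for u' v'
    by (rule free_cong_class_eq[symmetric]) (rule free_cong_append[OF that])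
  have "(\<Union>u'\<in>free_cong V G `` {u}. \<Union>v'\<in>free_cong V G `` {v}. free_cong V G `` {u' @ v'}) =
      (\<Union>u'\<in>free_cong V G `` {u}. \<Union>v'\<in>free_cong V G `` {v}. free_cong V G `` {u @ v})"
    by (intro SUP_cong refl eq) blast+
  also have "\<dots> = free_cong V G `` {u @ v}"
    using free_cong_refl[OF assms(1)] free_cong_refl[OF assms(2)] by blast
  finally show ?thesis
    by (simp add: free_product_def)
qed

lemma one_free_product: "\<one>\<^bsub>free_product V G\<^esub> = free_cong V G `` {[]}"
  by (simp add: free_product_def)

lemma free_cong_step:
  assumes "\<And>i. i \<in> V \<Longrightarrow> group (G i)" "free_step V G u v"
  shows "(u, v) \<in> free_cong V G"
proof -
  have "u \<in> free_words V G \<and> v \<in> free_words V G"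
    using assms(2)
    by cases (simp_all add: assms(1) group.is_monoid monoid.one_closed monoid.m_closed)
  with assms(2) show ?thesis
    by (auto simp: free_cong_def)
qed

lemma free_word_inverse:
  assumes "\<And>i. i \<in> V \<Longrightarrow> group (G i)" "w \<in> free_words V G"
  shows "\<exists>w'\<in>free_words V G. (w' @ w, []) \<in> free_cong V G"
  using assms(2)
proof (induction w)
  case Nil
  then show ?case by (intro bexI[of _ "[]"]) (auto simp: free_cong_refl)
next
  case (Cons l w)
  obtain i g where l: "l = (i, g)" by force
  with Cons.prems have ig: "i \<in> V" "g \<in> carrier (G i)" and w: "w \<in> free_words V G" by auto
  interpret Gi: group "G i" using assms(1) ig by blast
  from Cons.IH w obtain w' where w': "w' \<in> free_words V G" "(w' @ w, []) \<in> free_cong V G"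
    by blast
  let ?w = "w' @ [(i, inv\<^bsub>G i\<^esub> g)]"
  have "free_step V G (w' @ [(i, inv\<^bsub>G i\<^esub> g), (i, g)] @ w) (w' @ [(i, inv\<^bsub>G i\<^esub> g \<otimes>\<^bsub>G i\<^esub> g)] @ w)"
    by (rule free_step.mult) (use w w' ig in auto)
  moreover have "free_step V G (w' @ [(i, inv\<^bsub>G i\<^esub> g \<otimes>\<^bsub>G i\<^esub> g)] @ w) (w' @ w)"
    using free_step.one[OF w'(1) w ig(1)] ig by simp
  ultimately have "equivclp (free_step V G) (w' @ [(i, inv\<^bsub>G i\<^esub> g), (i, g)] @ w) []"
    using w'(2) unfolding free_cong_def by (blast intro: equivclp_trans r_into_equivclp)
  then have "(?w @ l # w, []) \<in> free_cong V G"
    using w w' ig l by (auto simp: free_cong_def)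
  moreover have "?w \<in> free_words V G" using w' ig by auto
  ultimately show ?case by blast
qed

lemma group_free_product:
  assumes "\<And>i. i \<in> V \<Longrightarrow> group (G i)"
  shows "group (free_product V G)"
proof (rule groupI)
  show "\<one>\<^bsub>free_product V G\<^esub> \<in> carrier (free_product V G)"
    by (simp add: one_free_product)
next
  fix X Y assume "X \<in> carrier (free_product V G)" "Y \<in> carrier (free_product V G)"
  then show "X \<otimes>\<^bsub>free_product V G\<^esub> Y \<in> carrier (free_product V G)"
    by (auto simp: mult_free_product elim!: carrier_free_productE)
next
  fix X Y Z
  assume "X \<in> carrier (free_product V G)" "Y \<in> carrier (free_product V G)"
    "Z \<in> carrier (free_product V G)"
  then show "X \<otimes>\<^bsub>free_product V G\<^esub> Y \<otimes>\<^bsub>free_product V G\<^esub> Z =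
    X \<otimes>\<^bsub>free_product V G\<^esub> (Y \<otimes>\<^bsub>free_product V G\<^esub> Z)"
    by (auto simp: mult_free_product elim!: carrier_free_productE)
next
  fix X assume X: "X \<in> carrier (free_product V G)"
  then show "\<one>\<^bsub>free_product V G\<^esub> \<otimes>\<^bsub>free_product V G\<^esub> X = X"
    by (auto simp: mult_free_product one_free_product elim!: carrier_free_productE)
  from X obtain w where w: "w \<in> free_words V G" "X = free_cong V G `` {w}"
    by (rule carrier_free_productE)
  obtain w' where w': "w' \<in> free_words V G" "(w' @ w, []) \<in> free_cong V G"
    using free_word_inverse[OF assms w(1)] by blast
  have "free_cong V G `` {w'} \<otimes>\<^bsub>free_product V G\<^esub> X = \<one>\<^bsub>free_product V G\<^esub>"
    unfolding w(2) mult_free_product[OF w'(1) w(1)] one_free_product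
    by (rule free_cong_class_eq[OF w'(2)])
  then show "\<exists>Y\<in>carrier (free_product V G). Y \<otimes>\<^bsub>free_product V G\<^esub> X = \<one>\<^bsub>free_product V G\<^esub>"
    by (rule bexI[OF _ free_class_closed[OF w'(1)]])
qed

lemma free_incl_hom:
  assumes "\<And>i. i \<in> V \<Longrightarrow> group (G i)" "i \<in> V"
  shows "free_incl V G i \<in> hom (G i) (free_product V G)"
proof (rule homI)
  fix g h assume gh: "g \<in> carrier (G i)" "h \<in> carrier (G i)"
  have *: "([(i, g), (i, h)], [(i, g \<otimes>\<^bsub>G i\<^esub> h)]) \<in> free_cong V G"
    using free_step.mult[of "[]" V G "[]" i g h] assms gh
    by (intro free_cong_step) simp_all
  show "free_incl V G i (g \<otimes>\<^bsub>G i\<^esub> h) =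
      free_incl V G i g \<otimes>\<^bsub>free_product V G\<^esub> free_incl V G i h"
    using gh assms(2) by (simp add: free_incl_def mult_free_product free_cong_class_eq[OF *])
qed (simp add: free_incl_def assms(2))

lemma (in group) commutator_eq:
  "\<lbrakk>x \<in> carrier G; y \<in> carrier G\<rbrakk> \<Longrightarrow> commutator G x y = (x \<otimes> y) \<otimes> inv (y \<otimes> x)"
  by (simp add: commutator_def inv_mult_group m_assoc)

lemma (in group) commutator_mult:
  "\<lbrakk>x \<in> carrier G; y \<in> carrier G\<rbrakk> \<Longrightarrow> commutator G x y \<otimes> (y \<otimes> x) = x \<otimes> y"
  by (simp only: commutator_eq m_assoc m_closed inv_closed l_inv r_one)

lemma (in group) normal_normal_closure:
  assumes "S \<subseteq> carrier G"
  shows "normal_closure G S \<lhd> G"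
proof -
  have self: "carrier G \<lhd> G"
    by (rule normal_invI) (auto simp: subgroup_self)
  then have *: "carrier G \<in> {N. N \<lhd> G \<and> S \<subseteq> N}" using assms by blast
  have "subgroup (normal_closure G S) G"
    unfolding normal_closure_def
    by (rule subgroups_Inter) (use * in \<open>blast intro: normal_imp_subgroup\<close>)+
  then show ?thesis
    by (rule normal_invI) (simp add: normal_closure_def normal.inv_op_closed2)
qed

lemma normal_closure_incl: "S \<subseteq> normal_closure G S"
  by (auto simp: normal_closure_def)

lemma normal_closure_minimal: "\<lbrakk>N \<lhd> G; S \<subseteq> N\<rbrakk> \<Longrightarrow> normal_closure G S \<subseteq> N"
  by (auto simp: normal_closure_def)

lemma graph_relators_subset:
  assumes "\<And>i. i \<in> V \<Longrightarrow> group (G i)"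
  shows "graph_relators V E G \<subseteq> carrier (free_product V G)"
proof -
  interpret F: group "free_product V G" by (rule group_free_product[OF assms])
  show ?thesis
    by (auto simp: graph_relators_def commutator_def free_incl_def)
qed

lemma normal_graph_relators:
  assumes "\<And>i. i \<in> V \<Longrightarrow> group (G i)"
  shows "normal_closure (free_product V G) (graph_relators V E G) \<lhd> free_product V G"
  by (intro group.normal_normal_closure group_free_product graph_relators_subset assms)

lemma group_graph_product:
  assumes "\<And>i. i \<in> V \<Longrightarrow> group (G i)"
  shows "group (graph_product V E G)"
  unfolding graph_product_def
  by (rule normal.factorgroup_is_group[OF normal_graph_relators[OF assms]])

lemma graph_incl_hom:
  assumes "\<And>i. i \<in> V \<Longrightarrow> group (G i)" "i \<in> V"
  shows "graph_incl V E G i \<in> hom (G i) (graph_product V E G)"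
  using hom_compose[OF free_incl_hom[OF assms] normal.r_coset_hom_Mod[OF normal_graph_relators[OF assms(1)]]]
  by (simp add: graph_incl_def[abs_def] graph_product_def comp_def)

lemma graph_incl_commute:
  assumes "\<And>i. i \<in> V \<Longrightarrow> group (G i)" "i \<in> V" "j \<in> V" "{i, j} \<in> E"
    "g \<in> carrier (G i)" "h \<in> carrier (G j)"
  shows "graph_incl V E G i g \<otimes>\<^bsub>graph_product V E G\<^esub> graph_incl V E G j h =
    graph_incl V E G j h \<otimes>\<^bsub>graph_product V E G\<^esub> graph_incl V E G i g"
proof -
  let ?F = "free_product V G" and ?N = "normal_closure (free_product V G) (graph_relators V E G)"
  interpret N: normal ?N ?F by (rule normal_graph_relators[OF assms(1)])
  let ?x = "free_incl V G i g" and ?y = "free_incl V G j h"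
  have x: "?x \<in> carrier ?F" and y: "?y \<in> carrier ?F"
    using assms by (auto simp: free_incl_def)
  have "commutator ?F ?x ?y \<in> ?N"
    using assms by (intro subsetD[OF normal_closure_incl]) (auto simp: graph_relators_def)
  moreover have "commutator ?F ?x ?y \<otimes>\<^bsub>?F\<^esub> (?y \<otimes>\<^bsub>?F\<^esub> ?x) = ?x \<otimes>\<^bsub>?F\<^esub> ?y"
    using x y by (rule N.commutator_mult)
  moreover have "?N #>\<^bsub>?F\<^esub> c = ?N" if "c \<in> ?N" for c
    by (rule N.coset_join2[OF N.mem_carrier[OF that] N.subgroup_axioms that])
  ultimately have "?N #>\<^bsub>?F\<^esub> (?x \<otimes>\<^bsub>?F\<^esub> ?y) = ?N #>\<^bsub>?F\<^esub> (?y \<otimes>\<^bsub>?F\<^esub> ?x)"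
    using N.coset_mult_assoc[OF N.subset N.mem_carrier N.m_closed[OF y x],
      of "commutator ?F ?x ?y"] by simp
  then show ?thesis
    using x y by (simp add: graph_incl_def graph_product_def N.rcos_sum)
qed

lemma word_lift_Nil [simp]: "word_lift H f [] = \<one>\<^bsub>H\<^esub>"
  by (simp add: word_lift_def)

lemma word_lift_Cons [simp]: "word_lift H f ((i, g) # w) = f i g \<otimes>\<^bsub>H\<^esub> word_lift H f w"
  by (simp add: word_lift_def)

context
  fixes V :: "'v set" and G :: "'v \<Rightarrow> ('a, 'b) monoid_scheme" and H :: "('c, 'd) monoid_scheme"
    and f :: "'v \<Rightarrow> 'a \<Rightarrow> 'c"
  assumes groups: "\<And>i. i \<in> V \<Longrightarrow> group (G i)" and group_H: "group H"
    and f: "\<And>i. i \<in> V \<Longrightarrow> f i \<in> hom (G i) H"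
begin

interpretation H: group H by (rule group_H)

lemma f_closed: "\<lbrakk>i \<in> V; g \<in> carrier (G i)\<rbrakk> \<Longrightarrow> f i g \<in> carrier H"
  using f by (auto simp: hom_def)

lemma word_lift_closed: "w \<in> free_words V G \<Longrightarrow> word_lift H f w \<in> carrier H"
  by (induction w) (auto simp: f_closed)

lemma word_lift_append:
  "\<lbrakk>u \<in> free_words V G; v \<in> free_words V G\<rbrakk>
    \<Longrightarrow> word_lift H f (u @ v) = word_lift H f u \<otimes>\<^bsub>H\<^esub> word_lift H f v"
  by (induction u) (auto simp: f_closed word_lift_closed H.m_assoc)

lemma word_lift_step:
  assumes "free_step V G u v"
  shows "word_lift H f u = word_lift H f v"
  using assms
proof cases
  case (one xs ys i)
  then have "f i \<one>\<^bsub>G i\<^esub> = \<one>\<^bsub>H\<^esub>" and "\<one>\<^bsub>G i\<^esub> \<in> carrier (G i)"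
    using f groups group_H by (auto intro: hom_one group.is_monoid monoid.one_closed)
  then show ?thesis
    using one by (simp add: word_lift_append word_lift_closed)
next
  case (mult xs ys i g h)
  then have "f i (g \<otimes>\<^bsub>G i\<^esub> h) = f i g \<otimes>\<^bsub>H\<^esub> f i h" and "g \<otimes>\<^bsub>G i\<^esub> h \<in> carrier (G i)"
    using f groups by (auto simp: hom_def group.is_monoid monoid.m_closed)
  then show ?thesis
    using mult by (simp add: word_lift_append word_lift_closed f_closed H.m_assoc)
qed

lemma word_lift_cong:
  assumes "(u, v) \<in> free_cong V G"
  shows "word_lift H f u = word_lift H f v"
proof -
  have "equivclp (free_step V G) u v" using assms by (simp add: free_cong_def)
  then show ?thesis
    by (induction rule: equivclp_induct) (auto dest: word_lift_step)
qed

lemma free_lift_class: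
  assumes "w \<in> free_words V G"
  shows "the_elem (word_lift H f ` (free_cong V G `` {w})) = word_lift H f w"
proof -
  have "word_lift H f ` (free_cong V G `` {w}) = {word_lift H f w}"
    using free_cong_refl[OF assms] by (auto dest: word_lift_cong)
  then show ?thesis by simp
qed

lemma free_lift_hom: "(\<lambda>X. the_elem (word_lift H f ` X)) \<in> hom (free_product V G) H"
  by (rule homI)
    (auto simp: free_lift_class mult_free_product word_lift_closed word_lift_append
      elim!: carrier_free_productE)

context
  fixes E :: "'v set set"
  assumes comm: "\<And>i j g h. \<lbrakk>i \<in> V; j \<in> V; {i, j} \<in> E; g \<in> carrier (G i); h \<in> carrier (G j)\<rbrakk>
    \<Longrightarrow> f i g \<otimes>\<^bsub>H\<^esub> f j h = f j h \<otimes>\<^bsub>H\<^esub> f i g"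
begin

lemma normal_closure_le_kernel:
  "normal_closure (free_product V G) (graph_relators V E G) \<subseteq>
    kernel (free_product V G) H (\<lambda>X. the_elem (word_lift H f ` X))"
proof -
  let ?F = "free_product V G" and ?\<phi> = "\<lambda>X. the_elem (word_lift H f ` X)"
  interpret \<phi>: group_hom ?F H ?\<phi>
    by (intro group_hom.intro group_hom_axioms.intro free_lift_hom group_H
        group_free_product groups)
  have "?\<phi> (commutator ?F (free_incl V G i g) (free_incl V G j h)) = \<one>\<^bsub>H\<^esub>"
    if "i \<in> V" "j \<in> V" "{i, j} \<in> E" "g \<in> carrier (G i)" "h \<in> carrier (G j)" for i j g h
  proof -
    have F: "free_incl V G i g \<in> carrier ?F" "free_incl V G j h \<in> carrier ?F"
      "f i g \<in> carrier H" "f j h \<in> carrier H"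
      using that by (auto simp: free_incl_def f_closed)
    have \<phi>: "?\<phi> (free_incl V G i g) = f i g" "?\<phi> (free_incl V G j h) = f j h"
      using that by (auto simp: free_incl_def free_lift_class f_closed)
    have "?\<phi> (commutator ?F (free_incl V G i g) (free_incl V G j h)) =
        (f i g \<otimes>\<^bsub>H\<^esub> f j h) \<otimes>\<^bsub>H\<^esub> inv\<^bsub>H\<^esub> (f j h \<otimes>\<^bsub>H\<^esub> f i g)"
      by (simp only: \<phi>.G.commutator_eq \<phi>.hom_mult \<phi>.hom_inv \<phi>.G.m_closed \<phi>.G.inv_closed F \<phi>)
    then show ?thesis
      using comm[OF that] F by simp
  qed
  then have "graph_relators V E G \<subseteq> kernel ?F H ?\<phi>"
    using graph_relators_subset[of V G E, OF groups]
    unfolding graph_relators_def kernel_def by blast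
  then show ?thesis
    by (rule normal_closure_minimal[OF \<phi>.normal_kernel])
qed

lemma graph_lift_coset:
  assumes "w \<in> free_words V G"
  shows "graph_lift H f (normal_closure (free_product V G) (graph_relators V E G)
    #>\<^bsub>free_product V G\<^esub> (free_cong V G `` {w})) = word_lift H f w"
proof -
  let ?F = "free_product V G" and ?N = "normal_closure (free_product V G) (graph_relators V E G)"
  let ?\<phi> = "\<lambda>X. the_elem (word_lift H f ` X)"
  interpret N: normal ?N ?F by (rule normal_graph_relators[of V G E, OF groups])
  have "word_lift H f u = word_lift H f w"
    if "u \<in> X" "X \<in> ?N #>\<^bsub>?F\<^esub> (free_cong V G `` {w})" for u X
  proof -
    from that(2) obtain n where n: "n \<in> ?N" "X = n \<otimes>\<^bsub>?F\<^esub> free_cong V G `` {w}"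
      by (auto simp: r_coset_def)
    from n have nF: "n \<in> carrier ?F" and n1: "?\<phi> n = \<one>\<^bsub>H\<^esub>"
      using normal_closure_le_kernel by (auto simp: kernel_def)
    from nF obtain v where v: "v \<in> free_words V G" "n = free_cong V G `` {v}"
      by (rule carrier_free_productE)
    with n1 have v1: "word_lift H f v = \<one>\<^bsub>H\<^esub>"
      by (simp add: free_lift_class)
    from v n that(1) assms have "(v @ w, u) \<in> free_cong V G"
      by (simp add: mult_free_product)
    then show ?thesis
      using word_lift_cong[of "v @ w" u] v v1 assms by (simp add: word_lift_append word_lift_closed)
  qed
  moreover have "w \<in> \<Union>(?N #>\<^bsub>?F\<^esub> (free_cong V G `` {w}))"
    using free_cong_refl[OF assms] N.rcos_self[of "free_cong V G `` {w}"] assms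
      N.subgroup_axioms by auto
  ultimately have "word_lift H f ` \<Union>(?N #>\<^bsub>?F\<^esub> (free_cong V G `` {w})) = {word_lift H f w}"
    by blast
  then show ?thesis by (simp add: graph_lift_def)
qed

lemma graph_lift_hom: "graph_lift H f \<in> hom (graph_product V E G) H"
proof -
  let ?F = "free_product V G" and ?N = "normal_closure (free_product V G) (graph_relators V E G)"
  interpret N: normal ?N ?F by (rule normal_graph_relators[of V G E, OF groups])
  show ?thesis
    by (rule homI)
      (auto simp: graph_product_def carrier_FactGroup N.rcos_sum graph_lift_coset
        mult_free_product word_lift_closed word_lift_append elim!: carrier_free_productE)
qed

lemma graph_lift_incl:
  "\<lbrakk>i \<in> V; g \<in> carrier (G i)\<rbrakk> \<Longrightarrow> graph_lift H f (graph_incl V E G i g) = f i g"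
  using graph_lift_coset[of "[(i, g)]"] by (simp add: graph_incl_def free_incl_def f_closed)

lemma graph_lift_unique:
  assumes \<psi>: "\<psi> \<in> hom (graph_product V E G) H"
    and incl: "\<And>i g. \<lbrakk>i \<in> V; g \<in> carrier (G i)\<rbrakk> \<Longrightarrow> \<psi> (graph_incl V E G i g) = f i g"
    and X: "X \<in> carrier (graph_product V E G)"
  shows "\<psi> X = graph_lift H f X"
proof -
  let ?F = "free_product V G" and ?N = "normal_closure (free_product V G) (graph_relators V E G)"
  interpret N: normal ?N ?F by (rule normal_graph_relators[of V G E, OF groups])
  have *: "\<psi> (?N #>\<^bsub>?F\<^esub> (free_cong V G `` {w})) = word_lift H f w" if "w \<in> free_words V G" for w
    using that
  proof (induction w)
    case Nil
    then show ?case
      using hom_one[OF \<psi> group_graph_product[of V G E, OF groups] group_H]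
      by (simp add: graph_product_def N.coset_mult_one[OF N.subset] flip: one_free_product)
  next
    case (Cons l w)
    obtain i g where l: "l = (i, g)" by force
    with Cons.prems have ig: "i \<in> V" "g \<in> carrier (G i)" and w: "w \<in> free_words V G" by auto
    have "?N #>\<^bsub>?F\<^esub> (free_cong V G `` {l # w}) =
        graph_incl V E G i g \<otimes>\<^bsub>graph_product V E G\<^esub> (?N #>\<^bsub>?F\<^esub> (free_cong V G `` {w}))"
      using ig w by (simp add: graph_incl_def free_incl_def graph_product_def N.rcos_sum
          mult_free_product l)
    moreover have "graph_incl V E G i g \<in> carrier (graph_product V E G)"
      "?N #>\<^bsub>?F\<^esub> (free_cong V G `` {w}) \<in> carrier (graph_product V E G)"
      using ig w by (auto simp: graph_incl_def free_incl_def graph_product_def carrier_FactGroup)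
    ultimately show ?case
      using Cons.IH w ig l incl hom_mult[OF \<psi>] by simp
  qed
  from X obtain w where "w \<in> free_words V G" "X = ?N #>\<^bsub>?F\<^esub> (free_cong V G `` {w})"
    by (auto simp: graph_product_def carrier_FactGroup elim!: carrier_free_productE)
  then show ?thesis by (simp add: * graph_lift_coset)
qed

end

end

lemma product_incl_hom:
  assumes "\<And>i. i \<in> V \<Longrightarrow> group (G i)" "i \<in> V"
  shows "product_incl V G i \<in> hom (G i) (product_group V G)"
  by (rule homI)
    (auto simp: product_incl_def product_group_def fun_eq_iff restrict_def assms
      group.is_monoid monoid.one_closed monoid.l_one)

lemma product_incl_commute:
  assumes "\<And>i. i \<in> V \<Longrightarrow> group (G i)" "i \<noteq> j" "g \<in> carrier (G i)" "h \<in> carrier (G j)"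
  shows "product_incl V G i g \<otimes>\<^bsub>product_group V G\<^esub> product_incl V G j h =
    product_incl V G j h \<otimes>\<^bsub>product_group V G\<^esub> product_incl V G i g"
  using assms
  by (auto simp: product_incl_def product_group_def fun_eq_iff group.is_monoid monoid.one_closed
      monoid.l_one monoid.r_one)

context
  fixes V :: "'v set" and E :: "'v set set" and G :: "'v \<Rightarrow> ('a, 'b) monoid_scheme"
  assumes graph: "finite_simplicial_graph V E" and groups: "\<And>i. i \<in> V \<Longrightarrow> group (G i)"
begin

lemma edge_neq: "{i, j} \<in> E \<Longrightarrow> i \<noteq> j"
  using graph by (auto simp: finite_simplicial_graph_def)

lemma canonical_map_hom: "canonical_map V G \<in> hom (graph_product V E G) (product_group V G)"
  unfolding canonical_map_def
  by (intro graph_lift_hom groups product_incl_hom product_incl_commute)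
    (auto simp: groups edge_neq)

lemma canonical_map_incl:
  "\<lbrakk>i \<in> V; g \<in> carrier (G i)\<rbrakk>
    \<Longrightarrow> canonical_map V G (graph_incl V E G i g) = (\<lambda>j\<in>V. if j = i then g else \<one>\<^bsub>G j\<^esub>)"
  unfolding canonical_map_def product_incl_def[symmetric]
  by (intro graph_lift_incl groups product_incl_hom product_incl_commute)
    (auto simp: groups edge_neq)

lemma canonical_map_epi: "canonical_map V G \<in> epi (graph_product V E G) (product_group V G)"
proof -
  interpret \<phi>: group_hom "graph_product V E G" "product_group V G" "canonical_map V G"
    by (intro group_hom.intro group_hom_axioms.intro canonical_map_hom group_graph_product groups)
      (auto simp: groups)
  let ?im = "canonical_map V G ` carrier (graph_product V E G)"
  have im: "subgroup ?im (product_group V G)"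
    by (rule \<phi>.img_is_subgroup)
  have "x \<in> ?im" if x: "x \<in> (\<Pi>\<^sub>E i\<in>V. carrier (G i))" for x
  proof -
    have "finite S \<Longrightarrow> S \<subseteq> V \<Longrightarrow> (\<lambda>j\<in>V. if j \<in> S then x j else \<one>\<^bsub>G j\<^esub>) \<in> ?im" for S
    proof (induction S rule: finite_induct)
      case empty
      then show ?case
        using subgroup.one_closed[OF im] by (simp add: product_group_def restrict_def)
    next
      case (insert i S)
      then have i: "i \<in> V" "x i \<in> carrier (G i)" using x by auto
      have "(\<lambda>j\<in>V. if j \<in> insert i S then x j else \<one>\<^bsub>G j\<^esub>) =
          (\<lambda>j\<in>V. if j = i then x i else \<one>\<^bsub>G j\<^esub>) \<otimes>\<^bsub>product_group V G\<^esub>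
          (\<lambda>j\<in>V. if j \<in> S then x j else \<one>\<^bsub>G j\<^esub>)"
        using insert.hyps groups PiE_mem[OF x]
        by (auto simp: product_group_def fun_eq_iff group.is_monoid)
      moreover have "(\<lambda>j\<in>V. if j = i then x i else \<one>\<^bsub>G j\<^esub>) \<in> ?im"
        unfolding canonical_map_incl[OF i, symmetric]
        by (intro imageI hom_in_carrier[OF graph_incl_hom[of V G i E, OF groups i(1)] i(2)])
      ultimately show ?case
        using insert.IH insert.prems subgroup.m_closed[OF im] by (simp only: insert_subset)
    qed
    from this[of V] graph x show ?thesis
      by (auto simp: finite_simplicial_graph_def PiE_def extensional_restrict
          cong: restrict_cong)
  qed
  then show ?thesis
    using \<phi>.homh by (auto simp: epi_def hom_def)
qed

end

end

theory Submission
  imports Defs "HOL-Algebra.Bij" "HOL-Algebra.FiniteProduct"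
begin

text \<open>Why the theorem holds: up to isomorphism, the kernel \<open>K\<close> of a graph product depends only on the
  graph and on the \<^emph>\<open>pointed sets\<close> underlying the vertex groups, and it is functorial in them. Let the
  graph product act on the direct product of the vertex groups through the canonical map and by
  left translation. A word, read from right to left, then traces a path from the base point in
  which each step changes at most one coordinate. The elements of \<open>K\<close> are the closed paths modulo the
  defining relations, which deform a path across triangles (three points that differ in one
  coordinate only) and across squares (two coordinates that are joined in the graph). None of this
  refers to multiplication.

  Hence maps \<open>\<phi>\<^sub>i : G\<^sub>i \<rightarrow> H\<^sub>i\<close> that preserve the identity, but need not be homomorphisms, push
  paths forward (\<open>transport_exists\<close>). The resulting map of graph products restricts to a homomorphism
  of the kernels (\<open>transport_kernel_hom\<close>), and pointed left inverses of the \<open>\<phi>\<^sub>i\<close> induce a left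
  inverse (\<open>transport_retraction\<close>). So pointed injections make one kernel a retract of the other, and
  pointed bijections make the kernels isomorphic.

  When the vertex groups are abelian, \<open>K\<close> is the commutator subgroup
  (\<open>commutator_subgroup_eq_kernel\<close>), so that the three claims reduce to pointed maps between sets: an
  infinite countable pointed set is in bijection with \<open>\<int>\<close>, a countable one embeds in \<open>\<int>\<close>, and a
  pointed set with at least two points contains a copy of \<open>\<int>/2\<close>.\<close>

section \<open>Graph products and their canonical maps\<close>

lemma BijGroup_simps:
  shows carrier_BijGroup: "carrier (BijGroup S) = Bij S"
    and one_BijGroup: "\<one>\<^bsub>BijGroup S\<^esub> = (\<lambda>x\<in>S. x)"
    and mult_BijGroup: "\<lbrakk>f \<in> Bij S; g \<in> Bij S\<rbrakk> \<Longrightarrow> f \<otimes>\<^bsub>BijGroup S\<^esub> g = compose S f g"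
  by (simp_all add: BijGroup_def)

locale graph_of_groups =
  fixes V :: "'v set" and E :: "'v set set" and G :: "'v \<Rightarrow> ('a, 'b) monoid_scheme"
  assumes graph: "finite_simplicial_graph V E" and groups: "\<And>i. i \<in> V \<Longrightarrow> group (G i)"
begin

abbreviation "GP \<equiv> graph_product V E G"
abbreviation "incl \<equiv> graph_incl V E G"
abbreviation "can \<equiv> canonical_map V G"
abbreviation "K \<equiv> kernel GP (product_group V G) can"

sublocale GP: group GP
  by (rule group_graph_product) (rule groups)

sublocale can: group_hom GP "product_group V G" can
  by (intro group_hom.intro group_hom_axioms.intro canonical_map_hom product_group GP.is_group
      groups graph)

lemma finite_V: "finite V"
  using graph by (simp add: finite_simplicial_graph_def)

lemma incl_hom: "i \<in> V \<Longrightarrow> incl i \<in> hom (G i) GP"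
  by (rule graph_incl_hom) (rule groups)

lemma incl_closed: "\<lbrakk>i \<in> V; g \<in> carrier (G i)\<rbrakk> \<Longrightarrow> incl i g \<in> carrier GP"
  using incl_hom by (rule hom_in_carrier)

lemma incl_one: "i \<in> V \<Longrightarrow> incl i \<one>\<^bsub>G i\<^esub> = \<one>\<^bsub>GP\<^esub>"
  by (rule hom_one[OF incl_hom groups GP.is_group])

lemma can_closed: "\<lbrakk>X \<in> carrier GP; i \<in> V\<rbrakk> \<Longrightarrow> can X i \<in> carrier (G i)"
  using can.hom_closed by (auto simp: PiE_def)

lemma can_one: "i \<in> V \<Longrightarrow> can \<one>\<^bsub>GP\<^esub> i = \<one>\<^bsub>G i\<^esub>"
  using can.hom_one by simp

lemma can_incl_mult:
  assumes "i \<in> V" "g \<in> carrier (G i)" "X \<in> carrier GP"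
  shows "can (incl i g \<otimes>\<^bsub>GP\<^esub> X) = (can X)(i := g \<otimes>\<^bsub>G i\<^esub> can X i)"
proof -
  have "can (incl i g) = (\<lambda>j\<in>V. if j = i then g else \<one>\<^bsub>G j\<^esub>)"
    by (intro canonical_map_incl[of V E] graph groups assms)
  moreover have "can X \<in> extensional V"
    using can.hom_closed[OF assms(3)] by (simp add: PiE_def)
  ultimately show ?thesis
    using assms can_closed[OF assms(3)]
    by (auto simp: incl_closed fun_eq_iff extensional_def groups group.is_monoid monoid.l_one)
qed

lemma can_mult:
  "\<lbrakk>X \<in> carrier GP; Y \<in> carrier GP; i \<in> V\<rbrakk> \<Longrightarrow> can (X \<otimes>\<^bsub>GP\<^esub> Y) i = can X i \<otimes>\<^bsub>G i\<^esub> can Y i"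
  by simp

lemma mem_K_iff: "X \<in> K \<longleftrightarrow> X \<in> carrier GP \<and> (\<forall>i\<in>V. can X i = \<one>\<^bsub>G i\<^esub>)"
proof -
  have "can X = (\<lambda>i\<in>V. \<one>\<^bsub>G i\<^esub>) \<longleftrightarrow> (\<forall>i\<in>V. can X i = \<one>\<^bsub>G i\<^esub>)" if "X \<in> carrier GP"
    using can.hom_closed[OF that] by (auto simp: PiE_def extensional_def fun_eq_iff)
  then show ?thesis by (auto simp: kernel_def)
qed

text \<open>Every element of the graph product is represented by a word, and this is induction on the word.\<close>

lemma graph_product_induct [consumes 1, case_names one incl]:
  assumes "X \<in> carrier GP"
    and one: "P \<one>\<^bsub>GP\<^esub>"
    and step: "\<And>i g Y. \<lbrakk>i \<in> V; g \<in> carrier (G i); Y \<in> carrier GP; P Y\<rbrakk> \<Longrightarrow> P (incl i g \<otimes>\<^bsub>GP\<^esub> Y)"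
  shows "P X"
proof -
  let ?F = "free_product V G" and ?N = "normal_closure (free_product V G) (graph_relators V E G)"
  interpret N: normal ?N ?F by (rule normal_graph_relators) (rule groups)
  have "P (?N #>\<^bsub>?F\<^esub> (free_cong V G `` {w}))" if "w \<in> free_words V G" for w
    using that
  proof (induction w)
    case Nil
    then show ?case
      using one by (simp add: graph_product_def N.coset_mult_one[OF N.subset] flip: one_free_product)
  next
    case (Cons l w)
    obtain i g where l: "l = (i, g)" by force
    with Cons.prems have ig: "i \<in> V" "g \<in> carrier (G i)" and w: "w \<in> free_words V G" by auto
    have "?N #>\<^bsub>?F\<^esub> (free_cong V G `` {l # w}) =
        incl i g \<otimes>\<^bsub>GP\<^esub> (?N #>\<^bsub>?F\<^esub> (free_cong V G `` {w}))"
      using ig w by (simp add: graph_incl_def free_incl_def graph_product_def N.rcos_sum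
          mult_free_product l)
    moreover have "?N #>\<^bsub>?F\<^esub> (free_cong V G `` {w}) \<in> carrier GP"
      using ig w by (auto simp: graph_product_def carrier_FactGroup)
    ultimately show ?case
      using step[OF ig] Cons.IH w by simp
  qed
  moreover obtain w where "w \<in> free_words V G" "X = ?N #>\<^bsub>?F\<^esub> (free_cong V G `` {w})"
    using assms(1) by (auto simp: graph_product_def carrier_FactGroup elim!: carrier_free_productE)
  ultimately show ?thesis by simp
qed

text \<open>Actions of the vertex groups on a set \<open>S\<close> that commute along the edges of the graph are
  homomorphisms to the permutation group of \<open>S\<close>, so by the universal property they combine to an
  action of the graph product. The orbit map at \<open>s\<close> is a function on the graph product that is
  defined by recursion on words.\<close>

lemma graph_product_recursion:
  assumes closed: "\<And>i g s. \<lbrakk>i \<in> V; g \<in> carrier (G i); s \<in> S\<rbrakk> \<Longrightarrow> act i g s \<in> S"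
    and one: "\<And>i s. \<lbrakk>i \<in> V; s \<in> S\<rbrakk> \<Longrightarrow> act i \<one>\<^bsub>G i\<^esub> s = s"
    and mult: "\<And>i g h s. \<lbrakk>i \<in> V; g \<in> carrier (G i); h \<in> carrier (G i); s \<in> S\<rbrakk>
      \<Longrightarrow> act i (g \<otimes>\<^bsub>G i\<^esub> h) s = act i g (act i h s)"
    and comm: "\<And>i j g h s. \<lbrakk>i \<in> V; j \<in> V; {i, j} \<in> E; g \<in> carrier (G i); h \<in> carrier (G j); s \<in> S\<rbrakk>
      \<Longrightarrow> act i g (act j h s) = act j h (act i g s)"
    and s: "s \<in> S"
  obtains T where "T \<in> carrier GP \<rightarrow> S" "T \<one>\<^bsub>GP\<^esub> = s"
    "\<And>i g X. \<lbrakk>i \<in> V; g \<in> carrier (G i); X \<in> carrier GP\<rbrakk> \<Longrightarrow> T (incl i g \<otimes>\<^bsub>GP\<^esub> X) = act i g (T X)"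
proof -
  define f where "f i g = restrict (act i g) S" for i g
  have Bij: "f i g \<in> Bij S" if "i \<in> V" "g \<in> carrier (G i)" for i g
  proof -
    interpret Gi: group "G i" using groups that by blast
    have "bij_betw (act i g) S S"
      using that
      by (intro bij_betw_byWitness[where f' = "act i (inv\<^bsub>G i\<^esub> g)"])
        (auto simp: closed one simp flip: mult)
    then show ?thesis
      by (simp add: Bij_def f_def cong: bij_betw_cong)
  qed
  have hom: "f i \<in> hom (G i) (BijGroup S)" if "i \<in> V" for i
    using that Bij by (intro homI)
      (auto simp: BijGroup_def f_def compose_def fun_eq_iff mult closed)
  let ?\<Theta> = "graph_lift (BijGroup S) f"
  have fcomm: "f i g \<otimes>\<^bsub>BijGroup S\<^esub> f j h = f j h \<otimes>\<^bsub>BijGroup S\<^esub> f i g"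
    if "i \<in> V" "j \<in> V" "{i, j} \<in> E" "g \<in> carrier (G i)" "h \<in> carrier (G j)" for i j g h
    using that Bij by (auto simp: BijGroup_def f_def compose_def fun_eq_iff comm[OF that] closed)
  have \<Theta>_incl: "?\<Theta> (incl i g) = f i g" if "i \<in> V" "g \<in> carrier (G i)" for i g
    by (rule graph_lift_incl[of V G "BijGroup S" f E]) (fact groups group_BijGroup hom fcomm that)+
  have "?\<Theta> \<in> hom GP (BijGroup S)"
    by (rule graph_lift_hom[of V G "BijGroup S" f E]) (fact groups group_BijGroup hom fcomm)+
  then interpret \<Theta>: group_hom GP "BijGroup S" ?\<Theta>
    by (intro group_hom.intro group_hom_axioms.intro group_BijGroup GP.is_group)
  have \<Theta>_closed: "?\<Theta> X \<in> Bij S" if "X \<in> carrier GP" for X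
    using \<Theta>.hom_closed[OF that] by (simp only: carrier_BijGroup)
  show ?thesis
  proof
    show "(\<lambda>X. ?\<Theta> X s) \<in> carrier GP \<rightarrow> S"
      using \<Theta>_closed Bij_imp_funcset s by fast
    show "?\<Theta> \<one>\<^bsub>GP\<^esub> s = s"
      using s by (simp only: \<Theta>.hom_one one_BijGroup restrict_apply')
  next
    fix i g X assume *: "i \<in> V" "g \<in> carrier (G i)" "X \<in> carrier GP"
    have "?\<Theta> X s \<in> S"
      using \<Theta>_closed[OF *(3)] Bij_imp_funcset s by fast
    moreover have "?\<Theta> (incl i g \<otimes>\<^bsub>GP\<^esub> X) = f i g \<otimes>\<^bsub>BijGroup S\<^esub> ?\<Theta> X"
      using * by (simp add: incl_closed \<Theta>_incl)
    ultimately show "?\<Theta> (incl i g \<otimes>\<^bsub>GP\<^esub> X) s = act i g (?\<Theta> X s)"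
      using * s by (simp only: mult_BijGroup Bij \<Theta>_closed compose_eq) (simp add: f_def)
  qed
qed

end


section \<open>Transport along pointed maps of the vertex groups\<close>

text \<open>The path of a word is pushed forward letter by letter, from right to left. If the part of the
  word already read ends at a point with \<open>i\<close>-th coordinate \<open>x\<close>, then the letter \<open>(i, g)\<close> moves this
  coordinate from \<open>x\<close> to \<open>g x\<close>; the image has to move from \<open>\<phi>\<^sub>i(x)\<close> to \<open>\<phi>\<^sub>i(g x)\<close>, which is left
  multiplication by \<open>\<phi>\<^sub>i(g x) \<phi>\<^sub>i(x)\<inverse>\<close>. These equations determine the map on the graph product; since many
  words represent the same element, that they can be satisfied needs proof.\<close>

definition is_transport ::
    "'v set \<Rightarrow> 'v set set \<Rightarrow> ('v \<Rightarrow> ('a, 'b) monoid_scheme) \<Rightarrow> ('v \<Rightarrow> ('c, 'd) monoid_scheme)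
      \<Rightarrow> ('v \<Rightarrow> 'a \<Rightarrow> 'c) \<Rightarrow> (('v \<times> 'a) list set set \<Rightarrow> ('v \<times> 'c) list set set) \<Rightarrow> bool" where
  "is_transport V E G H \<phi> T \<longleftrightarrow>
    T \<in> carrier (graph_product V E G) \<rightarrow> carrier (graph_product V E H) \<and>
    T \<one>\<^bsub>graph_product V E G\<^esub> = \<one>\<^bsub>graph_product V E H\<^esub> \<and>
    (\<forall>i\<in>V. \<forall>g\<in>carrier (G i). \<forall>X\<in>carrier (graph_product V E G).
      T (graph_incl V E G i g \<otimes>\<^bsub>graph_product V E G\<^esub> X) =
      graph_incl V E H i (\<phi> i (g \<otimes>\<^bsub>G i\<^esub> canonical_map V G X i) \<otimes>\<^bsub>H i\<^esub>
        inv\<^bsub>H i\<^esub> (\<phi> i (canonical_map V G X i))) \<otimes>\<^bsub>graph_product V E H\<^esub> T X)"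

locale pointed_maps = A: graph_of_groups V E G + B: graph_of_groups V E H
  for V :: "'v set" and E and G :: "'v \<Rightarrow> ('a, 'b) monoid_scheme"
    and H :: "'v \<Rightarrow> ('c, 'd) monoid_scheme" +
  fixes \<phi> :: "'v \<Rightarrow> 'a \<Rightarrow> 'c"
  assumes \<phi>_closed: "\<And>i g. \<lbrakk>i \<in> V; g \<in> carrier (G i)\<rbrakk> \<Longrightarrow> \<phi> i g \<in> carrier (H i)"
    and \<phi>_one: "\<And>i. i \<in> V \<Longrightarrow> \<phi> i \<one>\<^bsub>G i\<^esub> = \<one>\<^bsub>H i\<^esub>"
begin

abbreviation "transport \<equiv> is_transport V E G H \<phi>"

text \<open>The recursion needs the current point of the path as well as the image of the word read so far,
  so the vertex groups act on pairs of both. The action law for one vertex group is the cocycle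
  identity for the increments \<open>\<phi>\<^sub>i(g x) \<phi>\<^sub>i(x)\<inverse>\<close> (triangles). Letters at adjacent vertices act by
  commuting permutations because each leaves the coordinate of the other, and hence the increment of
  the other, unchanged (squares).\<close>

lemma transport_exists: "\<exists>T. transport T"
proof -
  define S where "S = (\<Pi>\<^sub>E i\<in>V. carrier (G i)) \<times> carrier B.GP"
  define d where "d i g x = \<phi> i (g \<otimes>\<^bsub>G i\<^esub> x i) \<otimes>\<^bsub>H i\<^esub> inv\<^bsub>H i\<^esub> (\<phi> i (x i))"
    for i g and x :: "'v \<Rightarrow> 'a"
  define act where
    "act i g = (\<lambda>(x, h). (x(i := g \<otimes>\<^bsub>G i\<^esub> x i), B.incl i (d i g x) \<otimes>\<^bsub>B.GP\<^esub> h))" for i g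
  have GH: "group (G i)" "group (H i)" "monoid (G i)" "monoid (H i)" if "i \<in> V" for i
    using A.groups B.groups group.is_monoid that by auto
  have d_closed: "d i g x \<in> carrier (H i)"
    if "i \<in> V" "g \<in> carrier (G i)" "x \<in> (\<Pi>\<^sub>E i\<in>V. carrier (G i))" for i g x
  proof -
    interpret Gi: group "G i" using GH that by blast
    interpret Hi: group "H i" using GH that by blast
    have "x i \<in> carrier (G i)" using that by auto
    then show ?thesis using that by (simp add: d_def \<phi>_closed)
  qed
  have upd: "x(i := g \<otimes>\<^bsub>G i\<^esub> x i) \<in> (\<Pi>\<^sub>E i\<in>V. carrier (G i))"
    if "i \<in> V" "g \<in> carrier (G i)" "x \<in> (\<Pi>\<^sub>E i\<in>V. carrier (G i))" for i g x
    using that GH[OF that(1)] by (auto simp: PiE_def Pi_def extensional_def monoid.m_closed)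
  have cocycle: "d i (g \<otimes>\<^bsub>G i\<^esub> h) x = d i g (x(i := h \<otimes>\<^bsub>G i\<^esub> x i)) \<otimes>\<^bsub>H i\<^esub> d i h x"
    if "i \<in> V" "g \<in> carrier (G i)" "h \<in> carrier (G i)" "x \<in> (\<Pi>\<^sub>E i\<in>V. carrier (G i))"
    for i g h x
  proof -
    interpret Gi: group "G i" using GH that by blast
    interpret Hi: group "H i" using GH that by blast
    have "x i \<in> carrier (G i)" using that by auto
    then show ?thesis
      using that by (simp add: d_def \<phi>_closed Gi.m_assoc Hi.m_assoc Hi.inv_solve_left
          flip: Hi.m_assoc[of "inv\<^bsub>H i\<^esub> (\<phi> i (h \<otimes>\<^bsub>G i\<^esub> x i))"])
  qed
  have "(\<lambda>i\<in>V. \<one>\<^bsub>G i\<^esub>, \<one>\<^bsub>B.GP\<^esub>) \<in> S"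
    using GH by (auto simp: S_def monoid.one_closed)
  then obtain R where R: "R \<in> carrier A.GP \<rightarrow> S" "R \<one>\<^bsub>A.GP\<^esub> = (\<lambda>i\<in>V. \<one>\<^bsub>G i\<^esub>, \<one>\<^bsub>B.GP\<^esub>)"
    "\<And>i g X. \<lbrakk>i \<in> V; g \<in> carrier (G i); X \<in> carrier A.GP\<rbrakk>
      \<Longrightarrow> R (A.incl i g \<otimes>\<^bsub>A.GP\<^esub> X) = act i g (R X)"
  proof (rule A.graph_product_recursion[rotated -2, of _ S act])
    fix i g s assume "i \<in> V" "g \<in> carrier (G i)" "s \<in> S"
    then show "act i g s \<in> S"
      using upd by (auto simp: act_def S_def d_closed B.incl_closed simp del: PiE_iff)
  next
    fix i s assume i: "i \<in> V" and s: "s \<in> S"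
    interpret Gi: group "G i" using GH i by blast
    interpret Hi: group "H i" using GH i by blast
    obtain x y where s: "s = (x, y)" "x \<in> (\<Pi>\<^sub>E i\<in>V. carrier (G i))" "y \<in> carrier B.GP"
      using s by (auto simp: S_def)
    then have "x i \<in> carrier (G i)" using i by auto
    then show "act i \<one>\<^bsub>G i\<^esub> s = s"
      using i s by (simp add: act_def d_def \<phi>_closed B.incl_one)
  next
    fix i g h s assume *: "i \<in> V" "g \<in> carrier (G i)" "h \<in> carrier (G i)" "s \<in> S"
    obtain x y where s: "s = (x, y)" "x \<in> (\<Pi>\<^sub>E i\<in>V. carrier (G i))" "y \<in> carrier B.GP"
      using *(4) by (auto simp: S_def)
    have "B.incl i (d i (g \<otimes>\<^bsub>G i\<^esub> h) x) =
        B.incl i (d i g (x(i := h \<otimes>\<^bsub>G i\<^esub> x i))) \<otimes>\<^bsub>B.GP\<^esub> B.incl i (d i h x)"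
      using * s by (simp only: cocycle)
        (intro hom_mult[OF B.incl_hom] d_closed upd; simp)
    moreover have "g \<otimes>\<^bsub>G i\<^esub> h \<otimes>\<^bsub>G i\<^esub> x i = g \<otimes>\<^bsub>G i\<^esub> (h \<otimes>\<^bsub>G i\<^esub> x i)"
      using * s PiE_mem[OF s(2) *(1)] GH[OF *(1)] by (simp add: monoid.m_assoc)
    ultimately show "act i (g \<otimes>\<^bsub>G i\<^esub> h) s = act i g (act i h s)"
      using * s d_closed[OF *(1,2) upd[OF *(1,3) s(2)]]
      by (simp add: act_def B.GP.m_assoc B.incl_closed d_closed)
  next
    fix i j g h s
    assume *: "i \<in> V" "j \<in> V" "{i, j} \<in> E" "g \<in> carrier (G i)" "h \<in> carrier (G j)" "s \<in> S"
    obtain x y where s: "s = (x, y)" "x \<in> (\<Pi>\<^sub>E i\<in>V. carrier (G i))" "y \<in> carrier B.GP"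
      using *(6) by (auto simp: S_def)
    have "i \<noteq> j" using edge_neq[OF A.graph A.groups *(3)] .
    moreover from this have "d i g (x(j := h \<otimes>\<^bsub>G j\<^esub> x j)) = d i g x"
      "d j h (x(i := g \<otimes>\<^bsub>G i\<^esub> x i)) = d j h x"
      by (simp_all add: d_def)
    moreover have "B.incl i (d i g x) \<otimes>\<^bsub>B.GP\<^esub> B.incl j (d j h x) =
        B.incl j (d j h x) \<otimes>\<^bsub>B.GP\<^esub> B.incl i (d i g x)"
      using * s by (intro graph_incl_commute B.groups d_closed) auto
    ultimately show "act i g (act j h s) = act j h (act i g s)"
      using * s by (simp add: act_def fun_upd_twist B.incl_closed d_closed
          flip: B.GP.m_assoc)
  qed blast
  \<comment> \<open>The first component of the state is the endpoint of the path.\<close>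
  have fst_R: "fst (R X) = A.can X" if "X \<in> carrier A.GP" for X
    using that
  proof (induction X rule: A.graph_product_induct)
    case one
    then show ?case by (simp add: R(2))
  next
    case (incl i g Y)
    then show ?case by (simp add: R(3) A.can_incl_mult act_def case_prod_beta)
  qed
  have "transport (snd \<circ> R)"
    unfolding is_transport_def
  proof (intro conjI ballI)
    show "snd \<circ> R \<in> carrier A.GP \<rightarrow> carrier B.GP"
      using R(1) by (auto simp: S_def Pi_def mem_Times_iff)
  qed (simp_all add: R(2,3) act_def case_prod_beta d_def fst_R)
  then show ?thesis by blast
qed

context
  fixes T assumes T: "transport T"
begin

lemma transport_closed: "X \<in> carrier A.GP \<Longrightarrow> T X \<in> carrier B.GP"
  using T by (auto simp: is_transport_def)

lemma transport_one: "T \<one>\<^bsub>A.GP\<^esub> = \<one>\<^bsub>B.GP\<^esub>"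
  using T by (auto simp: is_transport_def)

lemma transport_incl:
  "\<lbrakk>i \<in> V; g \<in> carrier (G i); X \<in> carrier A.GP\<rbrakk> \<Longrightarrow>
    T (A.incl i g \<otimes>\<^bsub>A.GP\<^esub> X) =
    B.incl i (\<phi> i (g \<otimes>\<^bsub>G i\<^esub> A.can X i) \<otimes>\<^bsub>H i\<^esub> inv\<^bsub>H i\<^esub> (\<phi> i (A.can X i))) \<otimes>\<^bsub>B.GP\<^esub> T X"
  using T by (auto simp: is_transport_def)

lemma increment_closed:
  assumes "i \<in> V" "g \<in> carrier (G i)" "x \<in> carrier (G i)"
  shows "\<phi> i (g \<otimes>\<^bsub>G i\<^esub> x) \<otimes>\<^bsub>H i\<^esub> inv\<^bsub>H i\<^esub> (\<phi> i x) \<in> carrier (H i)"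
  using A.groups B.groups assms \<phi>_closed
  by (meson group.inv_closed group.is_monoid monoid.m_closed)

text \<open>The pushed-forward path ends at the image of the endpoint. The paths start at the identity on
  both sides, which is where \<open>\<phi>\<close> has to preserve base points.\<close>

lemma can_transport:
  assumes "X \<in> carrier A.GP" "i \<in> V"
  shows "B.can (T X) i = \<phi> i (A.can X i)"
  using assms
proof (induction X rule: A.graph_product_induct)
  case one
  then show ?case by (simp only: transport_one A.can_one B.can_one \<phi>_one)
next
  case (incl j g Y)
  then interpret Gj: group "G j" using A.groups by blast
  interpret Hj: group "H j" using B.groups incl by blast
  show ?case
  proof (cases "i = j")
    case True
    then show ?thesis
      using incl A.can_closed[of Y j] \<phi>_closed[of j]
      by (simp add: transport_incl B.can_incl_mult A.can_incl_mult transport_closed increment_closed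
          A.can_closed Hj.m_assoc)
  next
    case False
    then show ?thesis
      using incl by (simp add: transport_incl B.can_incl_mult A.can_incl_mult transport_closed
          increment_closed A.can_closed)
  qed
qed

lemma transport_kernel: "X \<in> A.K \<Longrightarrow> T X \<in> B.K"
  by (auto simp: A.mem_K_iff B.mem_K_iff can_transport transport_closed \<phi>_one)

text \<open>Reading a product \<open>XY\<close> starts with \<open>Y\<close>. If \<open>Y\<close> is a closed path, then \<open>X\<close> is read from the base
  point on, exactly as if \<open>Y\<close> were absent.\<close>

lemma transport_mult_kernel:
  assumes "X \<in> carrier A.GP" "Y \<in> A.K"
  shows "T (X \<otimes>\<^bsub>A.GP\<^esub> Y) = T X \<otimes>\<^bsub>B.GP\<^esub> T Y"
  using assms(1)
proof (induction X rule: A.graph_product_induct)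
  case one
  then show ?case
    using assms(2) by (simp add: transport_one A.mem_K_iff transport_closed)
next
  case (incl i g X)
  from assms(2) have Y: "Y \<in> carrier A.GP" "A.can Y i = \<one>\<^bsub>G i\<^esub>"
    using incl by (auto simp: A.mem_K_iff)
  have "A.can (X \<otimes>\<^bsub>A.GP\<^esub> Y) i = A.can X i"
    using incl Y A.groups A.can_closed
    by (simp only: A.can_mult) (simp add: group.is_monoid monoid.r_one)
  with incl Y show ?case
    by (simp add: transport_incl transport_closed A.GP.m_assoc B.GP.m_assoc A.incl_closed
        B.incl_closed increment_closed A.can_closed)
qed

lemma transport_kernel_hom:
  "T \<in> hom (graph_product_kernel V E G) (graph_product_kernel V E H)"
  by (rule homI)
    (auto simp: graph_product_kernel_def transport_kernel intro!: transport_mult_kernel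
      dest: A.mem_K_iff[THEN iffD1])

end

end

text \<open>By \<open>can_transport\<close>, pushing forward along \<open>\<phi>\<close> and then along \<open>\<psi>\<close> turns the letter \<open>g\<close> at \<open>x\<close>
  into the increment \<open>\<psi>(\<phi>(g x)) \<psi>(\<phi>(x))\<inverse> = g\<close>.\<close>

lemma transport_retraction:
  assumes "pointed_maps V E G H \<phi>" "pointed_maps V E H G \<psi>"
    and T: "is_transport V E G H \<phi> T" and U: "is_transport V E H G \<psi> U"
    and retract: "\<And>i g. \<lbrakk>i \<in> V; g \<in> carrier (G i)\<rbrakk> \<Longrightarrow> \<psi> i (\<phi> i g) = g"
    and "X \<in> carrier (graph_product V E G)"
  shows "U (T X) = X"
proof -
  interpret \<phi>: pointed_maps V E G H \<phi> by fact
  interpret \<psi>: pointed_maps V E H G \<psi> by fact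
  show ?thesis
    using assms(6)
  proof (induction X rule: \<phi>.A.graph_product_induct)
    case one
    then show ?case
      by (simp only: \<phi>.transport_one[OF T] \<psi>.transport_one[OF U])
  next
    case (incl i g Y)
    then interpret Gi: group "G i" using \<phi>.A.groups by blast
    interpret Hi: group "H i" using \<phi>.B.groups incl by blast
    show ?case
      using incl \<phi>.A.can_closed[of Y i]
      by (simp add: \<phi>.transport_incl[OF T] \<psi>.transport_incl[OF U] \<phi>.transport_closed[OF T]
          \<phi>.increment_closed[OF T] \<phi>.can_transport[OF T] \<phi>.\<phi>_closed Hi.m_assoc Gi.m_assoc retract)
  qed
qed

text \<open>A pointed injection has a pointed left inverse: points outside the image go to the identity.\<close>

lemma kernel_transport_of_injections:
  assumes graph: "finite_simplicial_graph V E"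
    and groups: "\<And>i. i \<in> V \<Longrightarrow> group (G i)" "\<And>i. i \<in> V \<Longrightarrow> group (H i)"
    and \<phi>: "\<And>i. i \<in> V \<Longrightarrow> inj_on (\<phi> i) (carrier (G i))"
      "\<And>i. i \<in> V \<Longrightarrow> \<phi> i ` carrier (G i) \<subseteq> carrier (H i)"
      "\<And>i. i \<in> V \<Longrightarrow> \<phi> i \<one>\<^bsub>G i\<^esub> = \<one>\<^bsub>H i\<^esub>"
  shows "is_retract_of (graph_product_kernel V E G) (graph_product_kernel V E H)"
    and "(\<And>i. i \<in> V \<Longrightarrow> carrier (H i) \<subseteq> \<phi> i ` carrier (G i)) \<Longrightarrow>
      graph_product_kernel V E G \<cong> graph_product_kernel V E H"
proof -
  define \<psi> where "\<psi> i y =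
    (if y \<in> \<phi> i ` carrier (G i) then inv_into (carrier (G i)) (\<phi> i) y else \<one>\<^bsub>G i\<^esub>)" for i y
  have \<psi>\<phi>: "\<psi> i (\<phi> i g) = g" if "i \<in> V" "g \<in> carrier (G i)" for i g
    using that \<phi> by (simp add: \<psi>_def)
  have one: "\<one>\<^bsub>G i\<^esub> \<in> carrier (G i)" if "i \<in> V" for i
    using groups that by (simp add: group.is_monoid monoid.one_closed)
  interpret \<phi>: pointed_maps V E G H \<phi>
    by (intro pointed_maps.intro pointed_maps_axioms.intro graph_of_groups.intro)
      (use graph groups \<phi> in \<open>auto simp: image_subset_iff\<close>)
  interpret \<psi>: pointed_maps V E H G \<psi>
  proof (intro pointed_maps.intro pointed_maps_axioms.intro graph_of_groups.intro graph groups)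
    show "\<psi> i g \<in> carrier (G i)" if "i \<in> V" for i g
      using one that by (simp add: \<psi>_def inv_into_into)
    show "\<psi> i \<one>\<^bsub>H i\<^esub> = \<one>\<^bsub>G i\<^esub>" if "i \<in> V" for i
      using \<psi>\<phi>[OF that one] \<phi>(3) that by simp
  qed
  obtain T U where T: "is_transport V E G H \<phi> T" and U: "is_transport V E H G \<psi> U"
    using \<phi>.transport_exists \<psi>.transport_exists by blast
  let ?KG = "graph_product_kernel V E G" and ?KH = "graph_product_kernel V E H"
  have homs: "T \<in> hom ?KG ?KH" "U \<in> hom ?KH ?KG"
    by (rule \<phi>.transport_kernel_hom[OF T], rule \<psi>.transport_kernel_hom[OF U])
  have UT: "U (T X) = X" if "X \<in> carrier ?KG" for X
    using that by (intro transport_retraction[OF \<phi>.pointed_maps_axioms \<psi>.pointed_maps_axioms T U \<psi>\<phi>])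
      (auto simp: graph_product_kernel_def kernel_def)
  show "is_retract_of ?KG ?KH"
    using homs UT by (auto simp: is_retract_of_def)
  assume surj: "\<And>i. i \<in> V \<Longrightarrow> carrier (H i) \<subseteq> \<phi> i ` carrier (G i)"
  have "\<phi> i (\<psi> i h) = h" if "i \<in> V" "h \<in> carrier (H i)" for i h
    using surj that by (auto simp: \<psi>_def f_inv_into_f)
  then have TU: "T (U X) = X" if "X \<in> carrier ?KH" for X
    using that by (intro transport_retraction[OF \<psi>.pointed_maps_axioms \<phi>.pointed_maps_axioms U T])
      (auto simp: graph_product_kernel_def kernel_def)
  have "bij_betw T (carrier ?KG) (carrier ?KH)"
    by (rule bij_betw_byWitness[where f' = U]) (use homs UT TU in \<open>auto simp: hom_def\<close>)
  with homs show "?KG \<cong> ?KH"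
    by (auto simp: is_iso_def iso_def)
qed


section \<open>Abelian vertex groups\<close>

text \<open>The direct product is abelian, so the derived subgroup \<open>D\<close> lies in the kernel. Conversely,
  letters can be reordered and collected modulo \<open>D\<close>, so the class of \<open>X\<close> modulo \<open>D\<close> is the product
  over all vertices of the classes of its coordinates, and an element whose coordinates are trivial
  lies in \<open>D\<close>.\<close>

lemma commutator_subgroup_eq_kernel:
  assumes graph: "finite_simplicial_graph V E" and comm: "\<And>i. i \<in> V \<Longrightarrow> comm_group (G i)"
  shows "commutator_subgroup (graph_product V E G) = graph_product_kernel V E G"
proof -
  interpret graph_of_groups V E G
    by (rule graph_of_groups.intro) (use graph comm in \<open>auto simp: comm_group_def\<close>)
  let ?D = "derived GP (carrier GP)"
  interpret D: normal ?D GP by (rule GP.derived_self_is_normal)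
  interpret Q: comm_group "GP Mod ?D" by (rule GP.derived_quot_is_comm_group)
  interpret q: group_hom GP "GP Mod ?D" "\<lambda>X. ?D #>\<^bsub>GP\<^esub> X"
    by (intro group_hom.intro group_hom_axioms.intro D.r_coset_hom_Mod GP.is_group Q.is_group)
  have "?D = K"
  proof
    have "comm_group (product_group V G)"
      by (intro group.group_comm_groupI product_group groups)
        (auto simp: PiE_mem intro!: restrict_ext comm_monoid.m_comm[OF comm_group.axioms(1)[OF comm]])
    then have "can ` ?D = {\<one>\<^bsub>product_group V G\<^esub>}"
      using can.derived_img[of "carrier GP"] comm_group.derived_eq_singleton[of _ "can ` carrier GP"]
      by (metis can.hom_closed image_subsetI order_refl)
    then show "?D \<subseteq> K"
      using D.subset by (auto simp: kernel_def)
  next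
    have cl: "?D #>\<^bsub>GP\<^esub> incl i g \<in> carrier (GP Mod ?D)" if "i \<in> V" "g \<in> carrier (G i)" for i g
      using that by (intro q.hom_closed incl_closed)
    have *: "?D #>\<^bsub>GP\<^esub> X = (\<Otimes>\<^bsub>GP Mod ?D\<^esub>i\<in>V. ?D #>\<^bsub>GP\<^esub> incl i (can X i))"
      if "X \<in> carrier GP" for X
      using that
    proof (induction X rule: graph_product_induct)
      case one
      have "(\<Otimes>\<^bsub>GP Mod ?D\<^esub>i\<in>V. ?D #>\<^bsub>GP\<^esub> incl i (can \<one>\<^bsub>GP\<^esub> i)) = \<one>\<^bsub>GP Mod ?D\<^esub>"
        by (intro Q.finprod_one_eqI) (simp only: can_one incl_one q.hom_one)
      then show ?case by (simp only: q.hom_one)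
    next
      case (incl i g X)
      \<comment> \<open>A letter at \<open>i\<close> affects only the factor at \<open>i\<close>, which is therefore split off.\<close>
      let ?c = "\<lambda>X i. ?D #>\<^bsub>GP\<^esub> incl i (can X i)"
      let ?Y = "incl i g \<otimes>\<^bsub>GP\<^esub> X"
      have Y: "?Y \<in> carrier GP" using incl by (simp add: incl_closed)
      have i: "can ?Y i = g \<otimes>\<^bsub>G i\<^esub> can X i" using incl by (simp only: can_incl_mult fun_upd_same)
      have split: "(\<Otimes>\<^bsub>GP Mod ?D\<^esub>j\<in>V. ?c Z j) = ?c Z i \<otimes>\<^bsub>GP Mod ?D\<^esub> (\<Otimes>\<^bsub>GP Mod ?D\<^esub>j\<in>V-{i}. ?c Z j)"
        if "Z \<in> carrier GP" for Z
        using Q.finprod_insert[of "V - {i}" i "?c Z"] incl(1) that finite_V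
        by (simp add: insert_absorb cl can_closed Pi_def)
      have same: "(\<Otimes>\<^bsub>GP Mod ?D\<^esub>j\<in>V-{i}. ?c ?Y j) = (\<Otimes>\<^bsub>GP Mod ?D\<^esub>j\<in>V-{i}. ?c X j)"
        by (rule Q.finprod_cong') (use incl in \<open>auto simp: can_incl_mult can_closed cl\<close>)
      have "incl i (g \<otimes>\<^bsub>G i\<^esub> can X i) = incl i g \<otimes>\<^bsub>GP\<^esub> incl i (can X i)"
        using incl by (intro hom_mult[OF incl_hom] can_closed) auto
      then have "?c ?Y i = (?D #>\<^bsub>GP\<^esub> incl i g) \<otimes>\<^bsub>GP Mod ?D\<^esub> ?c X i"
        using incl by (simp only: i) (intro q.hom_mult incl_closed can_closed; simp)
      moreover have "?D #>\<^bsub>GP\<^esub> ?Y = (?D #>\<^bsub>GP\<^esub> incl i g) \<otimes>\<^bsub>GP Mod ?D\<^esub> (?D #>\<^bsub>GP\<^esub> X)"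
        using incl by (intro q.hom_mult incl_closed)
      moreover have "?D #>\<^bsub>GP\<^esub> incl i g \<in> carrier (GP Mod ?D)" "?c X i \<in> carrier (GP Mod ?D)"
        "(\<Otimes>\<^bsub>GP Mod ?D\<^esub>j\<in>V-{i}. ?c X j) \<in> carrier (GP Mod ?D)"
        using incl by (intro cl can_closed Q.finprod_closed Pi_I; simp)+
      ultimately show ?case
        by (simp only: split[OF Y] split[OF incl(3)] same incl.IH Q.m_assoc)
    qed
    show "K \<subseteq> ?D"
    proof
      fix X assume X: "X \<in> K"
      then have Xc: "X \<in> carrier GP" and "\<forall>i\<in>V. can X i = can \<one>\<^bsub>GP\<^esub> i"
        by (simp_all add: mem_K_iff can_one)
      then have "?D #>\<^bsub>GP\<^esub> X = ?D #>\<^bsub>GP\<^esub> \<one>\<^bsub>GP\<^esub>"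
        unfolding *[OF Xc] *[OF GP.one_closed]
        by (intro Q.finprod_cong') (auto intro!: cl monoid.one_closed group.is_monoid groups)
      then show "X \<in> ?D"
        using GP.rcos_self[OF Xc D.subgroup_axioms] by (simp add: GP.coset_mult_one[OF D.subset])
    qed
  qed
  then show ?thesis
    by (simp add: commutator_subgroup_def graph_product_kernel_def)
qed


section \<open>Comparison with right-angled Artin and Coxeter groups\<close>

theorem corollary1p4:
  fixes V :: "'v set" and E :: "'v set set" and G :: "'v \<Rightarrow> ('a, 'b) monoid_scheme"
  assumes "finite_simplicial_graph V E" and "\<And>i. i \<in> V \<Longrightarrow> group (G i)"
  shows "((\<forall>i\<in>V. infinite (carrier (G i)) \<and> countable (carrier (G i))) \<longrightarrow>
            graph_product_kernel V E G \<cong> commutator_subgroup (RAAG V E)) \<and>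
         ((\<forall>i\<in>V. countable (carrier (G i))) \<longrightarrow>
            is_retract_of (graph_product_kernel V E G) (commutator_subgroup (RAAG V E))) \<and>
         ((\<forall>i\<in>V. \<not> trivial_group (G i)) \<longrightarrow>
            is_retract_of (commutator_subgroup (RACG V E)) (graph_product_kernel V E G))"
proof -
  have RAAG: "commutator_subgroup (RAAG V E) = graph_product_kernel V E (\<lambda>_. integer_group)"
    unfolding RAAG_def by (rule commutator_subgroup_eq_kernel[OF assms(1) abelian_integer_group])
  have RACG: "commutator_subgroup (RACG V E) = graph_product_kernel V E (\<lambda>_. integer_mod_group 2)"
    unfolding RACG_def by (rule commutator_subgroup_eq_kernel[OF assms(1) abelian_integer_mod_group])
  have "graph_product_kernel V E G \<cong> commutator_subgroup (RAAG V E)"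
    if inf: "\<forall>i\<in>V. infinite (carrier (G i)) \<and> countable (carrier (G i))"
  proof -
    have "\<exists>b :: 'a \<Rightarrow> int. bij_betw b (carrier (G i)) UNIV" if "i \<in> V" for i
      using inf that bij_betw_trans[OF to_nat_on_infinite bij_int_decode] by blast
    then obtain b :: "'v \<Rightarrow> 'a \<Rightarrow> int"
      where b: "\<And>i. i \<in> V \<Longrightarrow> bij_betw (b i) (carrier (G i)) UNIV" by metis
    \<comment> \<open>Translation in \<open>\<int>\<close> moves the image of the identity to the base point 0.\<close>
    define \<phi> where "\<phi> i g = b i g - b i \<one>\<^bsub>G i\<^esub>" for i g
    have inj: "inj_on (\<phi> i) (carrier (G i))" if "i \<in> V" for i
      using b[OF that] by (auto simp: \<phi>_def inj_on_def bij_betw_def)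
    have surj: "y \<in> \<phi> i ` carrier (G i)" if "i \<in> V" for i y
    proof -
      have "y + b i \<one>\<^bsub>G i\<^esub> \<in> b i ` carrier (G i)"
        using b[OF that] by (simp add: bij_betw_def)
      then show ?thesis by (force simp: \<phi>_def)
    qed
    show ?thesis
      unfolding RAAG
      by (rule kernel_transport_of_injections(2)[where \<phi> = \<phi>])
        (use assms inj surj in \<open>auto simp: \<phi>_def\<close>)
  qed
  moreover have "is_retract_of (graph_product_kernel V E G) (commutator_subgroup (RAAG V E))"
    if count: "\<forall>i\<in>V. countable (carrier (G i))"
  proof -
    define \<phi> where "\<phi> i g = int (to_nat_on (carrier (G i)) g) - int (to_nat_on (carrier (G i)) \<one>\<^bsub>G i\<^esub>)"
      for i g
    have "inj_on (\<phi> i) (carrier (G i))" if "i \<in> V" for i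
      using inj_on_to_nat_on count that by (auto simp: \<phi>_def inj_on_def)
    then show ?thesis
      unfolding RAAG
      by (intro kernel_transport_of_injections(1)[where \<phi> = \<phi>])
        (use assms in \<open>auto simp: \<phi>_def\<close>)
  qed
  moreover have "is_retract_of (commutator_subgroup (RACG V E)) (graph_product_kernel V E G)"
    if nontriv: "\<forall>i\<in>V. \<not> trivial_group (G i)"
  proof -
    have one: "\<one>\<^bsub>G i\<^esub> \<in> carrier (G i)" if "i \<in> V" for i
      using assms(2)[OF that] by (simp add: group.is_monoid monoid.one_closed)
    have "\<exists>a\<in>carrier (G i). a \<noteq> \<one>\<^bsub>G i\<^esub>" if "i \<in> V" for i
      using nontriv that assms(2)[OF that] one[OF that] by (auto simp: trivial_group_def)
    then obtain a where a: "\<And>i. i \<in> V \<Longrightarrow> a i \<in> carrier (G i)" "\<And>i. i \<in> V \<Longrightarrow> a i \<noteq> \<one>\<^bsub>G i\<^esub>"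
      by metis
    define \<phi> where "\<phi> i n = (if n = 0 then \<one>\<^bsub>G i\<^esub> else a i)" for i and n :: int
    have "inj_on (\<phi> i) (carrier (integer_mod_group 2))" if "i \<in> V" for i
      using a(2)[OF that] a(2)[OF that, symmetric]
      by (auto simp: inj_on_def \<phi>_def carrier_integer_mod_group split: if_splits)
    then show ?thesis
      unfolding RACG
      by (intro kernel_transport_of_injections(1)[where \<phi> = \<phi>])
        (use assms a one in \<open>auto simp: \<phi>_def\<close>)
  qed
  ultimately show ?thesis by blast
qed

end
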